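(* Suppose $n\ge 6$. Whenever $\mathrm{Aut}(F_n)$ acts by isometries on a complete $\mathrm{CAT}(0)$ space, the Nielsen generators $\lambda_{ij}$ and $\rho_{ij}$ have zero translation length (i.e. they are either elliptic or else they are neutral parabolics).
   Context: $F_n$ is the free group of rank $n$ with a fixed basis $\{a_1,\dots,a_n\}$. For $i\neq j$, $\lambda_{ij}$ is the automorphism $a_i\mapsto a_ja_i,\ a_k\mapsto a_k\ (k\ne i)$ and $\rho_{ij}$ is the automorphism $a_i\mapsto a_ia_j,\ a_k\mapsto a_k\ (k\neq i)$. The translation length of an isometry $\gamma$ of a complete $\mathrm{CAT}(0)$ space $X$ is $\|\gamma\|=\inf\{d(x,\gamma.x)\mid x\in X\}$. The isometry $\gamma$ is elliptic if it fixes a point; it is parabolic if the infimum is not attained, and a parabolic is neutral if $\|\gamma\|=0$. *)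

theory Defs
  imports "HOL-Analysis.Analysis" "HOL-Algebra.Group_Action"
begin

section \<open>Free groups of finite rank\<close>

text \<open>The letter \<open>(k, True)\<close> stands for \<open>a\<^sub>k\<close> and \<open>(k, False)\<close> for its inverse.
  Elements of the free group of rank \<open>n\<close> are the freely reduced words over the letters with
  index in \<open>{1..n}\<close>; the product is concatenation followed by free reduction.\<close>

type_synonym letter = "nat \<times> bool"
type_synonym word = "letter list"

definition letter_inv :: "letter \<Rightarrow> letter" where
  "letter_inv l = (fst l, \<not> snd l)"

definition reduced_word :: "word \<Rightarrow> bool" where
  "reduced_word w \<longleftrightarrow> successively (\<lambda>l m. m \<noteq> letter_inv l) w"

fun cons_red :: "letter \<Rightarrow> word \<Rightarrow> word" where
  "cons_red l [] = [l]"
| "cons_red l (m # w) = (if m = letter_inv l then w else l # m # w)"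

definition free_group :: "nat \<Rightarrow> word monoid" where
  "free_group n =
    \<lparr>carrier = {w. fst ` set w \<subseteq> {1..n} \<and> reduced_word w},
     mult = (\<lambda>u v. foldr cons_red u v),
     one = []\<rparr>"

definition gen :: "nat \<Rightarrow> word" where
  "gen k = [(k, True)]"

text \<open>The homomorphism \<open>free_group n \<rightarrow> G\<close> that sends each basis element \<open>a\<^sub>k\<close> to \<open>s k\<close>. It is
  extensional, as the library requires of the elements of \<^const>\<open>auto\<close>.\<close>

definition free_lift :: "nat \<Rightarrow> ('g, 'm) monoid_scheme \<Rightarrow> (nat \<Rightarrow> 'g) \<Rightarrow> word \<Rightarrow> 'g" where
  "free_lift n G s = (\<lambda>w \<in> carrier (free_group n).
     foldr (\<lambda>(k, b) g. (if b then s k else inv\<^bsub>G\<^esub> (s k)) \<otimes>\<^bsub>G\<^esub> g) w \<one>\<^bsub>G\<^esub>)"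

definition nielsen_lambda :: "nat \<Rightarrow> nat \<Rightarrow> nat \<Rightarrow> word \<Rightarrow> word" where
  "nielsen_lambda n i j = free_lift n (free_group n)
     (\<lambda>k. if k = i then gen j \<otimes>\<^bsub>free_group n\<^esub> gen i else gen k)"

definition nielsen_rho :: "nat \<Rightarrow> nat \<Rightarrow> nat \<Rightarrow> word \<Rightarrow> word" where
  "nielsen_rho n i j = free_lift n (free_group n)
     (\<lambda>k. if k = i then gen i \<otimes>\<^bsub>free_group n\<^esub> gen j else gen k)"


subsection \<open>The construction is a group, free on the basis\<close>

lemma letter_inv_inv [simp]: "letter_inv (letter_inv l) = l"
  by (simp add: letter_inv_def)

lemma letter_inv_neq [simp]: "letter_inv l \<noteq> l" "l \<noteq> letter_inv l"
  by (auto simp: letter_inv_def prod_eq_iff)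

lemma fst_letter_inv [simp]: "fst (letter_inv l) = fst l"
  by (simp add: letter_inv_def)

lemma reduced_Nil [simp]: "reduced_word []"
  by (simp add: reduced_word_def)

lemma reduced_single [simp]: "reduced_word [l]"
  by (simp add: reduced_word_def)

lemma reduced_Cons2 [simp]:
  "reduced_word (l # m # w) \<longleftrightarrow> m \<noteq> letter_inv l \<and> reduced_word (m # w)"
  by (simp add: reduced_word_def)

lemma reduced_ConsD: "reduced_word (l # w) \<Longrightarrow> reduced_word w"
  by (cases w) auto

lemma reduced_cons_red: "reduced_word w \<Longrightarrow> reduced_word (cons_red l w)"
  by (cases w) (auto dest: reduced_ConsD)

lemma cons_red_cancel: "reduced_word w \<Longrightarrow> cons_red (letter_inv l) (cons_red l w) = w"
  by (cases "(l, w)" rule: cons_red.cases; cases "tl w") auto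

lemma cons_red_cancel': "reduced_word w \<Longrightarrow> cons_red l (cons_red (letter_inv l) w) = w"
  using cons_red_cancel[of w "letter_inv l"] by simp

lemma reduced_foldr: "reduced_word v \<Longrightarrow> reduced_word (foldr cons_red u v)"
  by (induction u) (auto simp: reduced_cons_red)

lemma foldr_cons_red_step:
  "reduced_word v \<Longrightarrow> foldr cons_red (cons_red l u) v = cons_red l (foldr cons_red u v)"
  by (cases u) (auto simp: cons_red_cancel' reduced_foldr)

lemma foldr_cons_red_assoc:
  "reduced_word w \<Longrightarrow>
    foldr cons_red (foldr cons_red u v) w = foldr cons_red u (foldr cons_red v w)"
  by (induction u) (auto simp: foldr_cons_red_step)

lemma foldr_cons_red_Nil: "reduced_word w \<Longrightarrow> foldr cons_red w [] = w"
proof (induction w)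
  case (Cons l w)
  then show ?case by (cases w) (auto dest: reduced_ConsD)
qed simp

lemma foldr_cons_red_inv:
  "reduced_word v \<Longrightarrow> foldr cons_red (rev (map letter_inv w)) (foldr cons_red w v) = v"
  by (induction w arbitrary: v) (auto simp: cons_red_cancel reduced_foldr)

lemma set_cons_red: "set (cons_red l w) \<subseteq> insert l (set w)"
  by (cases w) auto

lemma set_foldr_cons_red: "set (foldr cons_red u v) \<subseteq> set u \<union> set v"
  by (induction u) (use set_cons_red in fastforce)+

lemma free_group_carrier_iff:
  "w \<in> carrier (free_group n) \<longleftrightarrow> fst ` set w \<subseteq> {1..n} \<and> reduced_word w"
  by (simp add: free_group_def)

lemma free_group_mult: "u \<otimes>\<^bsub>free_group n\<^esub> v = foldr cons_red u v"
  by (simp add: free_group_def)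

lemma free_group_one: "\<one>\<^bsub>free_group n\<^esub> = []"
  by (simp add: free_group_def)

lemma foldr_in_free_group:
  assumes "fst ` set u \<subseteq> {1..n}" "v \<in> carrier (free_group n)"
  shows "foldr cons_red u v \<in> carrier (free_group n)"
proof -
  have "fst ` set (foldr cons_red u v) \<subseteq> fst ` (set u \<union> set v)"
    using set_foldr_cons_red by (rule image_mono)
  then show ?thesis
    using assms unfolding free_group_carrier_iff image_Un
    by (meson Un_least order.trans reduced_foldr)
qed

theorem group_free_group: "group (free_group n)"
proof (rule groupI)
  fix x y assume "x \<in> carrier (free_group n)" "y \<in> carrier (free_group n)"
  then show "x \<otimes>\<^bsub>free_group n\<^esub> y \<in> carrier (free_group n)"
    by (simp add: free_group_mult foldr_in_free_group free_group_carrier_iff[of x])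
next
  show "\<one>\<^bsub>free_group n\<^esub> \<in> carrier (free_group n)"
    by (simp add: free_group_one free_group_carrier_iff)
next
  fix x y z
  assume "z \<in> carrier (free_group n)"
  then show "x \<otimes>\<^bsub>free_group n\<^esub> y \<otimes>\<^bsub>free_group n\<^esub> z
      = x \<otimes>\<^bsub>free_group n\<^esub> (y \<otimes>\<^bsub>free_group n\<^esub> z)"
    by (simp add: free_group_mult foldr_cons_red_assoc free_group_carrier_iff)
next
  fix x
  show "\<one>\<^bsub>free_group n\<^esub> \<otimes>\<^bsub>free_group n\<^esub> x = x"
    by (simp add: free_group_mult free_group_one)
next
  fix x assume x: "x \<in> carrier (free_group n)"
  define y where "y = foldr cons_red (rev (map letter_inv x)) []"
  have "y \<in> carrier (free_group n)"
    unfolding y_def using x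
    by (intro foldr_in_free_group) (auto simp: free_group_carrier_iff)
  moreover have "foldr cons_red y x = []"
    using x foldr_cons_red_assoc[of x "rev (map letter_inv x)" "[]"]
      foldr_cons_red_inv[of "[]" x]
    by (simp add: y_def free_group_carrier_iff foldr_cons_red_Nil)
  ultimately show "\<exists>y\<in>carrier (free_group n). y \<otimes>\<^bsub>free_group n\<^esub> x = \<one>\<^bsub>free_group n\<^esub>"
    by (auto simp: free_group_mult free_group_one)
qed

lemma gen_in_free_group: "k \<in> {1..n} \<Longrightarrow> gen k \<in> carrier (free_group n)"
  by (simp add: gen_def free_group_carrier_iff)

context group
begin

definition eval_letter :: "(nat \<Rightarrow> 'a) \<Rightarrow> letter \<Rightarrow> 'a" where
  "eval_letter s l = (if snd l then s (fst l) else inv (s (fst l)))"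

definition eval_word :: "(nat \<Rightarrow> 'a) \<Rightarrow> word \<Rightarrow> 'a" where
  "eval_word s w = foldr (\<lambda>l g. eval_letter s l \<otimes> g) w \<one>"

lemma free_lift_eval: "w \<in> carrier (free_group n) \<Longrightarrow> free_lift n G s w = eval_word s w"
  by (simp add: free_lift_def eval_word_def eval_letter_def case_prod_beta')

lemma eval_word_simps [simp]:
  "eval_word s [] = \<one>" "eval_word s (l # w) = eval_letter s l \<otimes> eval_word s w"
  by (simp_all add: eval_word_def)

context
  fixes n and s :: "nat \<Rightarrow> 'a"
  assumes s: "\<And>k. k \<in> {1..n} \<Longrightarrow> s k \<in> carrier G"
begin

lemma eval_letter_closed: "fst l \<in> {1..n} \<Longrightarrow> eval_letter s l \<in> carrier G"
  using s by (simp add: eval_letter_def)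

lemma eval_letter_inv:
  "fst l \<in> {1..n} \<Longrightarrow> eval_letter s (letter_inv l) = inv (eval_letter s l)"
  using s by (simp add: eval_letter_def letter_inv_def)

lemma eval_word_closed: "fst ` set w \<subseteq> {1..n} \<Longrightarrow> eval_word s w \<in> carrier G"
  by (induction w) (auto intro!: m_closed eval_letter_closed)

lemma eval_word_cons_red:
  assumes "fst l \<in> {1..n}" "fst ` set w \<subseteq> {1..n}"
  shows "eval_word s (cons_red l w) = eval_letter s l \<otimes> eval_word s w"
proof (cases w)
  case (Cons m v)
  have "eval_word s v \<in> carrier G" "eval_letter s l \<in> carrier G"
    using assms Cons by (auto intro!: eval_word_closed eval_letter_closed)
  then show ?thesis
    using assms Cons
    by (auto simp: eval_letter_inv m_assoc[symmetric])
qed simp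

lemma eval_word_foldr:
  assumes "fst ` set u \<subseteq> {1..n}" "fst ` set v \<subseteq> {1..n}"
  shows "eval_word s (foldr cons_red u v) = eval_word s u \<otimes> eval_word s v"
  using assms(1)
proof (induction u)
  case Nil
  then show ?case using assms(2) by (simp add: eval_word_closed)
next
  case (Cons l u)
  have "fst ` set (foldr cons_red u v) \<subseteq> fst ` (set u \<union> set v)"
    using set_foldr_cons_red by (rule image_mono)
  then have "fst ` set (foldr cons_red u v) \<subseteq> {1..n}"
    using Cons.prems assms(2) unfolding image_Un set_simps image_insert insert_subset
    by (meson Un_least order.trans)
  then show ?case
    using Cons assms(2)
    by (simp add: eval_word_cons_red m_assoc eval_letter_closed eval_word_closed)
qed

theorem free_lift_hom: "free_lift n G s \<in> hom (free_group n) G"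
proof (rule homI)
  fix x y assume x: "x \<in> carrier (free_group n)" and y: "y \<in> carrier (free_group n)"
  show "free_lift n G s x \<in> carrier G"
    using x by (simp add: free_lift_eval eval_word_closed free_group_carrier_iff)
  have "x \<otimes>\<^bsub>free_group n\<^esub> y \<in> carrier (free_group n)"
    using x y group_free_group group.subgroup_self subgroup.m_closed by fast
  then show "free_lift n G s (x \<otimes>\<^bsub>free_group n\<^esub> y) = free_lift n G s x \<otimes> free_lift n G s y"
    using x y
    by (simp add: free_lift_eval free_group_mult eval_word_foldr free_group_carrier_iff)
qed

theorem free_lift_gen: "k \<in> {1..n} \<Longrightarrow> free_lift n G s (gen k) = s k"
  using s by (simp add: free_lift_eval gen_in_free_group)
    (simp add: gen_def eval_letter_def)

end

theorem hom_free_group_unique: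
  assumes f: "f \<in> hom (free_group n) G" and g: "g \<in> hom (free_group n) G"
    and eq: "\<And>k. k \<in> {1..n} \<Longrightarrow> f (gen k) = g (gen k)"
    and w: "w \<in> carrier (free_group n)"
  shows "f w = g w"
  using w
proof (induction w)
  case Nil
  interpret F: group "free_group n" by (rule group_free_group)
  show ?case
    using hom_one[OF f F.is_group is_group] hom_one[OF g F.is_group is_group]
    by (simp add: free_group_one)
next
  case (Cons l w)
  interpret F: group "free_group n" by (rule group_free_group)
  obtain k b where l: "l = (k, b)" by (cases l)
  have k: "k \<in> {1..n}" and w: "w \<in> carrier (free_group n)"
    and lF: "[l] \<in> carrier (free_group n)"
    using Cons.prems l by (auto simp: free_group_carrier_iff dest: reduced_ConsD)
  have dec: "l # w = [l] \<otimes>\<^bsub>free_group n\<^esub> w"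
    using Cons.prems by (cases w) (auto simp: free_group_mult free_group_carrier_iff)
  have "[l] = (if b then gen k else inv\<^bsub>free_group n\<^esub> gen k)"
  proof (cases b)
    case False
    have "[l] \<otimes>\<^bsub>free_group n\<^esub> gen k = \<one>\<^bsub>free_group n\<^esub>"
      using False l by (simp add: free_group_mult free_group_one gen_def letter_inv_def)
    then show ?thesis
      using False F.inv_equality lF gen_in_free_group[OF k] by simp
  qed (simp add: l gen_def)
  moreover have "f (inv\<^bsub>free_group n\<^esub> gen k) = inv f (gen k)"
    "g (inv\<^bsub>free_group n\<^esub> gen k) = inv g (gen k)"
    using f g gen_in_free_group[OF k] F.group_axioms is_group
    by (auto intro!: group_hom.hom_inv simp: group_hom_def group_hom_axioms_def)
  ultimately have "f [l] = g [l]" using eq[OF k] by auto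
  then show ?case
    unfolding dec using hom_mult[OF f lF w] hom_mult[OF g lF w] Cons.IH[OF w] by simp
qed

end


subsection \<open>The Nielsen generators are automorphisms\<close>

lemma free_group_auto_of_inverse:
  fixes n
  defines "F \<equiv> free_group n"
  assumes s: "\<And>k. k \<in> {1..n} \<Longrightarrow> s k \<in> carrier F"
    and t: "\<And>k. k \<in> {1..n} \<Longrightarrow> t k \<in> carrier F"
    and st: "\<And>k. k \<in> {1..n} \<Longrightarrow> free_lift n F s (t k) = gen k"
    and ts: "\<And>k. k \<in> {1..n} \<Longrightarrow> free_lift n F t (s k) = gen k"
  shows "free_lift n F s \<in> auto F"
proof -
  interpret F: group F unfolding F_def by (rule group_free_group)
  define f g where "f = free_lift n F s" and "g = free_lift n F t"
  have f: "f \<in> hom F F" and g: "g \<in> hom F F"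
    using F.free_lift_hom[of n s] F.free_lift_hom[of n t] s t
    by (simp_all add: f_def g_def F_def)
  have fk: "f (gen k) = s k" "g (gen k) = t k" if "k \<in> {1..n}" for k
    using F.free_lift_gen[of n s k] F.free_lift_gen[of n t k] s t that
    by (simp_all add: f_def g_def)
  have id: "(\<lambda>x. x) \<in> hom F F" by (simp add: hom_def)
  have "(g \<circ> f) w = w" if "w \<in> carrier F" for w
    using F.hom_free_group_unique[of "g \<circ> f" n "\<lambda>x. x" w] hom_compose[OF f g] id that fk ts
    by (simp add: F_def g_def)
  moreover have "(f \<circ> g) w = w" if "w \<in> carrier F" for w
    using F.hom_free_group_unique[of "f \<circ> g" n "\<lambda>x. x" w] hom_compose[OF g f] id that fk st
    by (simp add: F_def f_def)
  ultimately have "bij_betw f (carrier F) (carrier F)"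
    using f g by (intro bij_betwI[of _ _ _ g]) (auto simp: hom_def)
  moreover have "f \<in> extensional (carrier F)"
    by (simp add: f_def free_lift_def F_def)
  ultimately show ?thesis
    using f by (simp add: auto_def Bij_def f_def)
qed

lemma nielsen_gen:
  assumes "i \<in> {1..n}" "j \<in> {1..n}" "k \<in> {1..n}"
  shows "nielsen_lambda n i j (gen k) =
           (if k = i then gen j \<otimes>\<^bsub>free_group n\<^esub> gen i else gen k)"
    and "nielsen_rho n i j (gen k) =
           (if k = i then gen i \<otimes>\<^bsub>free_group n\<^esub> gen j else gen k)"
proof -
  interpret F: group "free_group n" by (rule group_free_group)
  show "nielsen_lambda n i j (gen k) =
           (if k = i then gen j \<otimes>\<^bsub>free_group n\<^esub> gen i else gen k)"
    unfolding nielsen_lambda_def using assms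
    by (subst F.free_lift_gen) (auto intro!: F.m_closed gen_in_free_group)
  show "nielsen_rho n i j (gen k) =
           (if k = i then gen i \<otimes>\<^bsub>free_group n\<^esub> gen j else gen k)"
    unfolding nielsen_rho_def using assms
    by (subst F.free_lift_gen) (auto intro!: F.m_closed gen_in_free_group)
qed

lemma nielsen_auto:
  assumes i: "i \<in> {1..n}" and j: "j \<in> {1..n}" and "i \<noteq> j"
  shows "nielsen_lambda n i j \<in> auto (free_group n)"
    and "nielsen_rho n i j \<in> auto (free_group n)"
proof -
  define F where "F = free_group n"
  interpret F: group F unfolding F_def by (rule group_free_group)
  have gen: "k \<in> {1..n} \<Longrightarrow> gen k \<in> carrier F" for k
    by (simp add: F_def gen_in_free_group)
  have lift_mult: "free_lift n F s (x \<otimes>\<^bsub>F\<^esub> y) = free_lift n F s x \<otimes>\<^bsub>F\<^esub> free_lift n F s y"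
    and lift_inv: "free_lift n F s (inv\<^bsub>F\<^esub> x) = inv\<^bsub>F\<^esub> (free_lift n F s x)"
    if "\<And>k. k \<in> {1..n} \<Longrightarrow> s k \<in> carrier F" "x \<in> carrier F" "y \<in> carrier F" for s x y
  proof -
    have h: "free_lift n F s \<in> hom F F"
      using F.free_lift_hom[of n s] that by (simp add: F_def)
    then show "free_lift n F s (x \<otimes>\<^bsub>F\<^esub> y) = free_lift n F s x \<otimes>\<^bsub>F\<^esub> free_lift n F s y"
      using that by (simp add: hom_mult)
    show "free_lift n F s (inv\<^bsub>F\<^esub> x) = inv\<^bsub>F\<^esub> (free_lift n F s x)"
      using h that(2) by (auto intro!: group_hom.hom_inv
        simp: group_hom_def group_hom_axioms_def F.is_group)
  qed
  let ?s = "\<lambda>k. if k = i then gen j \<otimes>\<^bsub>F\<^esub> gen i else gen k"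
  let ?s' = "\<lambda>k. if k = i then inv\<^bsub>F\<^esub> gen j \<otimes>\<^bsub>F\<^esub> gen i else gen k"
  let ?r = "\<lambda>k. if k = i then gen i \<otimes>\<^bsub>F\<^esub> gen j else gen k"
  let ?r' = "\<lambda>k. if k = i then gen i \<otimes>\<^bsub>F\<^esub> inv\<^bsub>F\<^esub> gen j else gen k"
  have s: "\<forall>k \<in> {1..n}. ?s k \<in> carrier F" and s': "\<forall>k \<in> {1..n}. ?s' k \<in> carrier F"
    and r: "\<forall>k \<in> {1..n}. ?r k \<in> carrier F" and r': "\<forall>k \<in> {1..n}. ?r' k \<in> carrier F"
    using i j gen by auto
  have cancel: "inv\<^bsub>F\<^esub> a \<otimes>\<^bsub>F\<^esub> (a \<otimes>\<^bsub>F\<^esub> b) = b" "a \<otimes>\<^bsub>F\<^esub> (inv\<^bsub>F\<^esub> a \<otimes>\<^bsub>F\<^esub> b) = b"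
    "b \<otimes>\<^bsub>F\<^esub> a \<otimes>\<^bsub>F\<^esub> inv\<^bsub>F\<^esub> a = b" "b \<otimes>\<^bsub>F\<^esub> inv\<^bsub>F\<^esub> a \<otimes>\<^bsub>F\<^esub> a = b"
    if "a \<in> carrier F" "b \<in> carrier F" for a b
    using that by (simp_all add: F.m_assoc) (simp_all add: F.m_assoc[symmetric])
  have lift_simps:
    "k \<in> {1..n} \<Longrightarrow> free_lift n F q (gen k) = q k"
    "\<lbrakk>k \<in> {1..n}; l \<in> {1..n}\<rbrakk> \<Longrightarrow> free_lift n F q (gen k \<otimes>\<^bsub>F\<^esub> gen l) = q k \<otimes>\<^bsub>F\<^esub> q l"
    "\<lbrakk>k \<in> {1..n}; l \<in> {1..n}\<rbrakk> \<Longrightarrow>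
      free_lift n F q (inv\<^bsub>F\<^esub> gen k \<otimes>\<^bsub>F\<^esub> gen l) = inv\<^bsub>F\<^esub> q k \<otimes>\<^bsub>F\<^esub> q l"
    "\<lbrakk>k \<in> {1..n}; l \<in> {1..n}\<rbrakk> \<Longrightarrow>
      free_lift n F q (gen k \<otimes>\<^bsub>F\<^esub> inv\<^bsub>F\<^esub> gen l) = q k \<otimes>\<^bsub>F\<^esub> inv\<^bsub>F\<^esub> q l"
    if "\<forall>k \<in> {1..n}. q k \<in> carrier F" for q k l
    using lift_mult[of q] lift_inv[of q _ "\<one>\<^bsub>F\<^esub>"] F.free_lift_gen[of n q] gen that by simp_all
  have "free_lift n F ?s \<in> auto F"
  proof (rule free_group_auto_of_inverse[of n ?s ?s', folded F_def])
    fix k assume k: "k \<in> {1..n}"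
    show "free_lift n F ?s (?s' k) = gen k"
      using k i j gen \<open>i \<noteq> j\<close> by (auto simp: lift_simps[of ?s, OF s] cancel)
    show "free_lift n F ?s' (?s k) = gen k"
      using k i j gen \<open>i \<noteq> j\<close> by (auto simp: lift_simps[of ?s', OF s'] cancel)
  qed (use s s' in auto)
  then show "nielsen_lambda n i j \<in> auto (free_group n)"
    unfolding nielsen_lambda_def F_def .
  have "free_lift n F ?r \<in> auto F"
  proof (rule free_group_auto_of_inverse[of n ?r ?r', folded F_def])
    fix k assume k: "k \<in> {1..n}"
    show "free_lift n F ?r (?r' k) = gen k"
      using k i j gen \<open>i \<noteq> j\<close> by (auto simp: lift_simps[of ?r, OF r] cancel)
    show "free_lift n F ?r' (?r k) = gen k"
      using k i j gen \<open>i \<noteq> j\<close> by (auto simp: lift_simps[of ?r', OF r'] cancel)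
  qed (use r r' in auto)
  then show "nielsen_rho n i j \<in> auto (free_group n)"
    unfolding nielsen_rho_def F_def .
qed


section \<open>CAT(0) spaces\<close>

text \<open>Metric spaces are given as subsets \<open>X\<close> of a type of class \<^class>\<open>metric_space\<close>, with the
  restricted metric. All geodesics are required to lie inside \<open>X\<close>.\<close>

definition geodesic_segment :: "'a::metric_space set \<Rightarrow> 'a \<Rightarrow> 'a \<Rightarrow> 'a set \<Rightarrow> bool" where
  "geodesic_segment X x y S \<longleftrightarrow>
     (\<exists>c. c 0 = x \<and> c (dist x y) = y \<and>
          (\<forall>s \<in> {0..dist x y}. \<forall>t \<in> {0..dist x y}. dist (c s) (c t) = \<bar>s - t\<bar>) \<and>
          S = c ` {0..dist x y} \<and> S \<subseteq> X)"

definition geodesic_space :: "'a::metric_space set \<Rightarrow> bool" where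
  "geodesic_space X \<longleftrightarrow> (\<forall>x \<in> X. \<forall>y \<in> X. \<exists>S. geodesic_segment X x y S)"

text \<open>For \<open>p\<close> on a geodesic segment \<open>S\<close> from \<open>x\<close> to \<open>y\<close>, the comparison point on the Euclidean
  segment from \<open>x'\<close> to \<open>y'\<close> is the point at the same distance from the initial endpoint.\<close>

definition comparison_point ::
  "'a::metric_space \<Rightarrow> 'a set \<Rightarrow> real^2 \<Rightarrow> real^2 \<Rightarrow> 'a \<Rightarrow> real^2 \<Rightarrow> bool" where
  "comparison_point x S x' y' p p' \<longleftrightarrow>
     p \<in> S \<and> p' \<in> closed_segment x' y' \<and> dist x' p' = dist x p"

definition triangle_comparison_point ::
  "'a::metric_space \<Rightarrow> 'a \<Rightarrow> 'a \<Rightarrow> 'a set \<Rightarrow> 'a set \<Rightarrow> 'a set \<Rightarrow>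
   real^2 \<Rightarrow> real^2 \<Rightarrow> real^2 \<Rightarrow> 'a \<Rightarrow> real^2 \<Rightarrow> bool" where
  "triangle_comparison_point x y z Sxy Syz Szx x' y' z' p p' \<longleftrightarrow>
     comparison_point x Sxy x' y' p p' \<or>
     comparison_point y Syz y' z' p p' \<or>
     comparison_point z Szx z' x' p p'"

definition CAT0_space :: "'a::metric_space set \<Rightarrow> bool" where
  "CAT0_space X \<longleftrightarrow> geodesic_space X \<and>
     (\<forall>x \<in> X. \<forall>y \<in> X. \<forall>z \<in> X. \<forall>Sxy Syz Szx.
        geodesic_segment X x y Sxy \<and> geodesic_segment X y z Syz \<and> geodesic_segment X z x Szx \<longrightarrow>
        (\<forall>x' y' z'. dist x' y' = dist x y \<and> dist y' z' = dist y z \<and> dist z' x' = dist z x \<longrightarrow>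
           (\<forall>p q p' q'.
              triangle_comparison_point x y z Sxy Syz Szx x' y' z' p p' \<and>
              triangle_comparison_point x y z Sxy Syz Szx x' y' z' q q' \<longrightarrow>
              dist p q \<le> dist p' q')))"


section \<open>Isometries\<close>

definition isometric_action ::
  "('g, 'm) monoid_scheme \<Rightarrow> 'a::metric_space set \<Rightarrow> ('g \<Rightarrow> 'a \<Rightarrow> 'a) \<Rightarrow> bool" where
  "isometric_action G X \<phi> \<longleftrightarrow> group_action G X \<phi> \<and>
     (\<forall>g \<in> carrier G. \<forall>x \<in> X. \<forall>y \<in> X. dist (\<phi> g x) (\<phi> g y) = dist x y)"

definition translation_length :: "'a::metric_space set \<Rightarrow> ('a \<Rightarrow> 'a) \<Rightarrow> real" where
  "translation_length X f = (INF x \<in> X. dist x (f x))"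

definition elliptic :: "'a::metric_space set \<Rightarrow> ('a \<Rightarrow> 'a) \<Rightarrow> bool" where
  "elliptic X f \<longleftrightarrow> (\<exists>x \<in> X. f x = x)"

definition parabolic :: "'a::metric_space set \<Rightarrow> ('a \<Rightarrow> 'a) \<Rightarrow> bool" where
  "parabolic X f \<longleftrightarrow> \<not> (\<exists>x \<in> X. dist x (f x) = translation_length X f)"

definition neutral_parabolic :: "'a::metric_space set \<Rightarrow> ('a \<Rightarrow> 'a) \<Rightarrow> bool" where
  "neutral_parabolic X f \<longleftrightarrow> parabolic X f \<and> translation_length X f = 0"

end

theory Submission
  imports Defs "HOL-Algebra.Generated_Groups"
begin

text \<open>
  Let \<open>g\<close> be an isometry of a complete CAT(0) space with \<open>\<parallel>g\<parallel> > 0\<close>. The orbit \<open>g\<^sup>k x\<close> converges to a point at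
  infinity that the centralizer of \<open>g\<close> fixes, and the Busemann function there gives a homomorphism
  from the centralizer to the reals that does not vanish at \<open>g\<close>. Hence \<open>\<parallel>g\<parallel> = 0\<close> as soon as \<open>g\<close> is a
  product of commutators of elements that commute with \<open>g\<close>
  (\<open>translation_length_eq_0_if_derived_centralizer\<close>).

  The proof below replaces the point at infinity by the far away points \<open>g\<^sup>k x\<close> themselves. The
  midpoint inequality of CAT(0) spaces gives the quadrilateral inequality
  (\<open>cn_space_quadrilateral\<close>): the squares of the diagonals add up to at most the sum of the squares
  of the four sides. It implies that \<open>h \<mapsto> d(h x, g\<^sup>k x) - d(x, g\<^sup>k x)\<close> is additive on the centralizer up
  to an error at most inversely proportional to \<open>d(x, g\<^sup>k x)\<close> (\<open>cn_space_far_pairs\<close>), and no limit has to be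
  taken in the space.

  On the algebraic side, \<open>\<lambda>\<^sub>i\<^sub>j\<close> is a product of commutators in its own centralizer
  (\<open>nielsen_lambda_in_derived_centralizer\<close>). For a third index \<open>k\<close>, the automorphism \<open>E\<close> with
  \<open>a\<^sub>j \<mapsto> a\<^sub>k a\<^sub>j a\<^sub>k\<^sup>-\<^sup>1\<close> and \<open>a\<^sub>i \<mapsto> a\<^sub>k a\<^sub>i\<close> commutes with \<open>\<lambda>\<^sub>i\<^sub>j\<close>, and so do \<open>\<lambda>\<^sub>k\<^sub>j\<close> and
  \<open>\<rho>\<^sub>k\<^sub>j\<close>. They satisfy \<open>\<lambda>\<^sub>i\<^sub>j = \<rho>\<^sub>k\<^sub>j [\<lambda>\<^sub>k\<^sub>j, E] \<lambda>\<^sub>k\<^sub>j\<^sup>-\<^sup>1\<close>, where \<open>[u, v] = u v u\<^sup>-\<^sup>1 v\<^sup>-\<^sup>1\<close> and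
  the right factor of a product is applied first; and with a fourth index \<open>l\<close>, the elements
  \<open>\<lambda>\<^sub>k\<^sub>j\<close> and \<open>\<rho>\<^sub>k\<^sub>j\<close> are commutators of Nielsen automorphisms with indices \<open>k, l\<close> and \<open>l, j\<close>,
  which also commute with \<open>\<lambda>\<^sub>i\<^sub>j\<close>. Finally, inverting all basis elements conjugates \<open>\<lambda>\<^sub>i\<^sub>j\<close> to
  \<open>\<rho>\<^sub>i\<^sub>j\<close>.
\<close>

section \<open>Midpoints and quadrilaterals in CAT(0) spaces\<close>

lemma exists_euclidean_triangle:
  fixes a b c :: real
  assumes "0 \<le> a" "0 \<le> b" "0 \<le> c" "a \<le> b + c" "b \<le> a + c" "c \<le> a + b"
  shows "\<exists>x y z :: real^2. dist x y = b \<and> dist y z = a \<and> dist z x = c"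
proof (cases "a = 0")
  case True
  then have "c = b" using assms by linarith
  have "dist (vector [b, 0] :: real^2) 0 = b"
    using assms by (simp add: norm_eq_sqrt_inner inner_vec_def sum_2)
  then show ?thesis
    using True \<open>c = b\<close> by (metis dist_commute dist_self)
next
  case False
  then have a: "a > 0" using assms by simp
  \<comment> \<open>The side of length \<open>a\<close> lies on the first axis, and the law of cosines gives the
    first coordinate \<open>u\<close> of the opposite vertex.\<close>
  define u where "u = (a^2 + b^2 - c^2) / (2 * a)"
  have au: "2 * a * u = a^2 + b^2 - c^2" using a by (simp add: u_def)
  have "u \<le> b"
  proof -
    have "(a - b)^2 \<le> c^2"
      using assms by (intro abs_le_square_iff[THEN iffD1]) auto
    then have "2 * a * u \<le> 2 * a * b" using au by (simp add: power2_diff)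
    then show ?thesis using a by simp
  qed
  moreover have "- b \<le> u"
  proof -
    have "c^2 \<le> (a + b)^2" using assms by (intro power_mono) auto
    then have "2 * a * (- b) \<le> 2 * a * u" using au by (simp add: power2_sum)
    then show ?thesis using a by (simp only: mult_le_cancel_left_pos mult_pos_pos zero_less_numeral)
  qed
  ultimately have "u^2 \<le> b^2"
    using assms by (intro abs_le_square_iff[THEN iffD1]) auto
  then have v: "sqrt (b^2 - u^2) ^ 2 = b^2 - u^2" by simp
  define x y z :: "real^2" where "x = vector [u, sqrt (b^2 - u^2)]" and "y = 0"
    and "z = vector [a, 0]"
  have "dist x y = b"
    using assms v by (simp add: x_def y_def norm_eq_sqrt_inner inner_vec_def sum_2
      power2_eq_square[symmetric])
  moreover have "dist y z = a"
    using a by (simp add: y_def z_def norm_eq_sqrt_inner inner_vec_def sum_2)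
  moreover have "dist z x = c"
  proof -
    have "(a - u)^2 + (b^2 - u^2) = c^2"
      using au by (simp add: power2_diff)
    then show ?thesis
      using assms v by (simp add: x_def z_def dist_norm norm_eq_sqrt_inner inner_vec_def sum_2
        power2_eq_square[symmetric])
  qed
  ultimately show ?thesis by blast
qed

lemma median_length:
  fixes x y z :: "'a::euclidean_space"
  shows "(dist x (midpoint y z))\<^sup>2 = (dist x y)\<^sup>2 / 2 + (dist x z)\<^sup>2 / 2 - (dist y z)\<^sup>2 / 4"
  unfolding dist_norm power2_norm_eq_inner midpoint_def
  by (simp add: inner_diff_left inner_diff_right inner_add_left inner_add_right
      inner_commute field_simps)

text \<open>The inequality of Bruhat and Tits, with the Euclidean median length on the right-hand side.
  It is all that the argument needs to know of comparison triangles. Stating it for the midpoint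
  as a point, without a geodesic through it, makes it evident that isometries preserve it.\<close>

definition cn_midpoint :: "'a::metric_space set \<Rightarrow> 'a \<Rightarrow> 'a \<Rightarrow> 'a \<Rightarrow> bool" where
  "cn_midpoint X y z m \<longleftrightarrow> m \<in> X \<and>
     (\<forall>x \<in> X. (dist x m)\<^sup>2 \<le> (dist x y)\<^sup>2 / 2 + (dist x z)\<^sup>2 / 2 - (dist y z)\<^sup>2 / 4)"

definition cn_space :: "'a::metric_space set \<Rightarrow> bool" where
  "cn_space X \<longleftrightarrow> (\<forall>y \<in> X. \<forall>z \<in> X. \<exists>m. cn_midpoint X y z m)"

lemma CAT0_imp_cn_space:
  assumes "CAT0_space X"
  shows "cn_space X"
  unfolding cn_space_def
proof (intro ballI)
  fix y z assume y: "y \<in> X" and z: "z \<in> X"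
  have geo: "\<exists>S. geodesic_segment X p q S" if "p \<in> X" "q \<in> X" for p q
    using assms that unfolding CAT0_space_def geodesic_space_def by blast
  obtain Syz where Syz: "geodesic_segment X y z Syz" using geo y z by blast
  then obtain c where c: "c 0 = y" "c (dist y z) = z" "Syz = c ` {0..dist y z}" "Syz \<subseteq> X"
    "\<forall>s \<in> {0..dist y z}. \<forall>t \<in> {0..dist y z}. dist (c s) (c t) = \<bar>s - t\<bar>"
    unfolding geodesic_segment_def by blast
  define m where "m = c (dist y z / 2)"
  have m: "m \<in> Syz" by (simp add: m_def c(3))
  have ym: "dist y m = dist y z / 2"
  proof -
    have "dist (c 0) (c (dist y z / 2)) = \<bar>0 - dist y z / 2\<bar>"
      using c(5) by (intro c(5)[rule_format]) auto
    then show ?thesis by (simp add: m_def c(1))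
  qed
  have "(dist x m)\<^sup>2 \<le> (dist x y)\<^sup>2 / 2 + (dist x z)\<^sup>2 / 2 - (dist y z)\<^sup>2 / 4" if x: "x \<in> X" for x
  proof -
    obtain Sxy Szx where S: "geodesic_segment X x y Sxy" "geodesic_segment X z x Szx"
      using geo x y z by blast
    obtain x' y' z' :: "real^2" where
      t: "dist x' y' = dist x y" "dist y' z' = dist y z" "dist z' x' = dist z x"
      using exists_euclidean_triangle[of "dist y z" "dist x y" "dist z x"]
      by (smt (verit) dist_commute dist_triangle zero_le_dist)
    have "x \<in> Sxy"
      using S(1) unfolding geodesic_segment_def by force
    then have x_cmp: "triangle_comparison_point x y z Sxy Syz Szx x' y' z' x x'"
      by (simp add: triangle_comparison_point_def comparison_point_def)
    have m_cmp: "triangle_comparison_point x y z Sxy Syz Szx x' y' z' m (midpoint y' z')"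
      using m ym t by (simp add: triangle_comparison_point_def comparison_point_def dist_midpoint)
    have "dist x m \<le> dist x' (midpoint y' z')"
      using assms x y z Syz S t x_cmp m_cmp unfolding CAT0_space_def by blast
    then have "(dist x m)\<^sup>2 \<le> (dist x' (midpoint y' z'))\<^sup>2" by (simp add: power_mono)
    then show ?thesis
      using t by (simp add: median_length dist_commute)
  qed
  then show "\<exists>m. cn_midpoint X y z m"
    using m c(4) unfolding cn_midpoint_def by blast
qed

text \<open>The midpoint of one diagonal is joined to both ends of the other one, and the two
  medians obtained in this way bound that diagonal.\<close>

lemma cn_space_quadrilateral:
  assumes "cn_space X" "p \<in> X" "q \<in> X" "r \<in> X" "s \<in> X"
  shows "(dist p r)\<^sup>2 + (dist q s)\<^sup>2
    \<le> (dist p q)\<^sup>2 + (dist q r)\<^sup>2 + (dist r s)\<^sup>2 + (dist s p)\<^sup>2"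
proof -
  obtain m where m: "cn_midpoint X p r m"
    using assms unfolding cn_space_def by blast
  have 1: "(dist q m)\<^sup>2 \<le> (dist q p)\<^sup>2 / 2 + (dist q r)\<^sup>2 / 2 - (dist p r)\<^sup>2 / 4"
    and 2: "(dist s m)\<^sup>2 \<le> (dist s p)\<^sup>2 / 2 + (dist s r)\<^sup>2 / 2 - (dist p r)\<^sup>2 / 4"
    using m assms unfolding cn_midpoint_def by blast+
  have "(dist q s)\<^sup>2 \<le> (dist q m + dist s m)\<^sup>2"
    by (intro power_mono) (auto simp: dist_triangle2)
  also have "\<dots> \<le> 2 * (dist q m)\<^sup>2 + 2 * (dist s m)\<^sup>2"
    using sum_squares_bound[of "dist q m" "dist s m"] by (simp add: power2_sum)
  finally show ?thesis
    using 1 2 by (simp add: dist_commute)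
qed

text \<open>Write \<open>d\<close> for the distance. When the pair \<open>z, z'\<close> moves away from the pair \<open>y, y'\<close> while
  \<open>d(y, y')\<close> and \<open>d(z, z')\<close> stay bounded, the differences \<open>d(y, z') - d(y, z)\<close> and
  \<open>d(y', z') - d(y', z)\<close> become equal in the limit. The quadrilateral inequality, applied to the
  two cyclic orders that exchange the roles of diagonals and long sides, bounds
  \<open>d(y, z')\<^sup>2 + d(y', z)\<^sup>2 - d(y, z)\<^sup>2 - d(y', z')\<^sup>2\<close> on both sides by the squares of the short
  distances. All four distances differ from \<open>d(y, z)\<close> by a bounded amount, so up to a bounded error
  this expression is \<open>2 d(y, z)\<close> times the difference in question.\<close>

lemma cn_space_far_pairs:
  assumes X: "cn_space X" "y \<in> X" "y' \<in> X" "z \<in> X" "z' \<in> X"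
  shows "\<bar>dist y z' - dist y z - dist y' z' + dist y' z\<bar> * dist y z
    \<le> 2 * ((dist y y')\<^sup>2 + (dist z z')\<^sup>2)"
proof -
  define P r s q where "P = dist y z" and "r = dist y z' - P" and "s = dist y' z - P"
    and "q = dist y' z' - P"
  define a c where "a = dist y y'" and "c = dist z z'"
  have "(P + r)\<^sup>2 + (P + s)\<^sup>2 \<le> a\<^sup>2 + (P + q)\<^sup>2 + c\<^sup>2 + P\<^sup>2"
    using cn_space_quadrilateral[OF X(1), of y y' z' z] X
    by (simp add: P_def r_def s_def q_def a_def c_def dist_commute)
  moreover have "P\<^sup>2 + (P + q)\<^sup>2 \<le> a\<^sup>2 + (P + s)\<^sup>2 + c\<^sup>2 + (P + r)\<^sup>2"
    using cn_space_quadrilateral[OF X(1), of y y' z z'] X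
    by (simp add: P_def r_def s_def q_def a_def c_def dist_commute)
  ultimately have 1: "\<bar>2 * P * (r + s - q) + r\<^sup>2 + s\<^sup>2 - q\<^sup>2\<bar> \<le> a\<^sup>2 + c\<^sup>2"
    by (simp add: power2_sum algebra_simps)
  have r: "\<bar>r\<bar> \<le> c" and s: "\<bar>s\<bar> \<le> a" and q: "\<bar>q\<bar> \<le> a + c"
    unfolding P_def r_def s_def q_def a_def c_def
    using dist_triangle[of y z' z] dist_triangle[of y z z'] dist_triangle[of y' z y]
      dist_triangle[of y z y'] dist_triangle[of y' z' y] dist_triangle[of y z' y']
      dist_triangle[of y z z'] dist_triangle[of y z' z]
    by (simp_all add: dist_commute abs_le_iff)
  have "r\<^sup>2 \<le> c\<^sup>2" "s\<^sup>2 \<le> a\<^sup>2" "q\<^sup>2 \<le> (a + c)\<^sup>2"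
    using power_mono[OF r, of 2] power_mono[OF s, of 2] power_mono[OF q, of 2] by auto
  moreover have "(a + c)\<^sup>2 \<le> 2 * a\<^sup>2 + 2 * c\<^sup>2"
    using sum_squares_bound[of a c] by (simp add: power2_sum)
  ultimately have "\<bar>2 * P * (r + s - q)\<bar> \<le> 4 * (a\<^sup>2 + c\<^sup>2)"
    using 1 zero_le_power2[of r] zero_le_power2[of s] zero_le_power2[of q]
    unfolding abs_le_iff by (smt (verit))
  moreover have "P \<ge> 0" by (simp add: P_def)
  ultimately have "\<bar>r + s - q\<bar> * P \<le> 2 * (a\<^sup>2 + c\<^sup>2)"
    by (simp only: abs_mult abs_numeral abs_of_nonneg) (simp add: mult.commute)
  moreover have "dist y z' - dist y z - dist y' z' + dist y' z = r + s - q"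
    by (simp add: r_def s_def q_def P_def)
  ultimately show ?thesis by (simp add: P_def a_def c_def)
qed

text \<open>The median inequality at \<open>m'\<close> bounds the distance from \<open>m\<close> to \<open>m'\<close> by the distances of \<open>m\<close>
  from \<open>y\<close> and \<open>z\<close>, and the median inequality at \<open>m\<close> bounds these by the sides of the triangle.\<close>

lemma cn_midpoints_of_triangle_sides:
  assumes m: "cn_midpoint X x y m" and m': "cn_midpoint X y z m'"
    and X: "x \<in> X" "y \<in> X" "z \<in> X"
  shows "2 * dist m m' \<le> dist x z"
proof -
  have "(dist m m')\<^sup>2 \<le> (dist m y)\<^sup>2 / 2 + (dist m z)\<^sup>2 / 2 - (dist y z)\<^sup>2 / 4"
    using m m' unfolding cn_midpoint_def by blast
  moreover have "(dist y m)\<^sup>2 \<le> (dist y x)\<^sup>2 / 2 + (dist y y)\<^sup>2 / 2 - (dist x y)\<^sup>2 / 4"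
    and "(dist z m)\<^sup>2 \<le> (dist z x)\<^sup>2 / 2 + (dist z y)\<^sup>2 / 2 - (dist x y)\<^sup>2 / 4"
    using m X unfolding cn_midpoint_def by blast+
  ultimately have "(2 * dist m m')\<^sup>2 \<le> (dist x z)\<^sup>2"
    by (simp add: dist_commute)
  then show ?thesis by (rule power2_le_imp_le) simp
qed

section \<open>Centralizers and derived subgroups\<close>

definition centralizer :: "('g, 'm) monoid_scheme \<Rightarrow> 'g \<Rightarrow> 'g set" where
  "centralizer G f = {g \<in> carrier G. f \<otimes>\<^bsub>G\<^esub> g = g \<otimes>\<^bsub>G\<^esub> f}"

lemma (in group) subgroup_centralizer:
  assumes f: "f \<in> carrier G"
  shows "subgroup (centralizer G f) G"
proof (rule subgroupI)
  note mem = centralizer_def[of G f]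
  show "centralizer G f \<subseteq> carrier G" by (auto simp: mem)
  have "\<one> \<in> centralizer G f" using f by (simp add: mem)
  then show "centralizer G f \<noteq> {}" by blast
  show "inv g \<in> centralizer G f" if "g \<in> centralizer G f" for g
    using that f unfolding mem mem_Collect_eq
    by (metis inv_closed inv_solve_left inv_solve_right m_assoc m_closed)
  show "g \<otimes> h \<in> centralizer G f" if "g \<in> centralizer G f" "h \<in> centralizer G f" for g h
    using that f unfolding mem mem_Collect_eq by (metis m_assoc m_closed)
qed

lemma (in group) cancel_left:
  assumes "x \<in> carrier G" "y \<in> carrier G"
  shows "x \<otimes> (inv x \<otimes> y) = y" "inv x \<otimes> (x \<otimes> y) = y"
  using assms by (metis inv_closed l_inv l_one m_assoc r_inv)+

lemma (in group) mem_derived_if_swap: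
  assumes H: "subgroup H G" and uv: "u \<in> H" "v \<in> H" and w: "w \<in> carrier G"
    and eq: "v \<otimes> u = u \<otimes> v \<otimes> w"
  shows "w \<in> derived G H"
proof -
  interpret H: subgroup H G by (rule H)
  have [simp]: "u \<in> carrier G" "v \<in> carrier G" using uv by auto
  have "w = inv (u \<otimes> v) \<otimes> (v \<otimes> u)"
    using w by (simp add: eq inv_solve_left)
  also have "\<dots> = inv v \<otimes> inv u \<otimes> inv (inv v) \<otimes> inv (inv u)"
    by (simp add: inv_mult_group m_assoc)
  finally have "w \<in> derived_set G H"
    using H.m_inv_closed uv by blast
  then show ?thesis
    unfolding derived_def by (rule generate.incl)
qed

text \<open>A real-valued function that is additive up to an error tending to \<open>0\<close> vanishes in the limit on
  \<open>\<one>\<close>, hence is odd in the limit, hence vanishes in the limit on commutators and on everything they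
  generate. The filter is arbitrary because it will express that an orbit is far away.\<close>

lemma (in group) asymptotic_hom_vanishes_on_derived:
  fixes \<beta> :: "'i \<Rightarrow> 'a \<Rightarrow> real"
  assumes H: "subgroup H G"
    and hom: "\<And>g h. g \<in> H \<Longrightarrow> h \<in> H \<Longrightarrow> ((\<lambda>k. \<beta> k (g \<otimes> h) - \<beta> k g - \<beta> k h) \<longlongrightarrow> 0) F"
    and g: "g \<in> derived G H"
  shows "((\<lambda>k. \<beta> k g) \<longlongrightarrow> 0) F"
proof -
  interpret H: subgroup H G by (rule H)
  have mult: "((\<lambda>k. \<beta> k (g \<otimes> h)) \<longlongrightarrow> 0) F"
    if "g \<in> H" "h \<in> H" "((\<lambda>k. \<beta> k g + \<beta> k h) \<longlongrightarrow> 0) F" for g h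
    using tendsto_add[OF hom[OF that(1,2)] that(3)] by simp
  have one: "((\<lambda>k. \<beta> k \<one>) \<longlongrightarrow> 0) F"
    using tendsto_minus[OF hom[of \<one> \<one>]] by simp
  have inv_sum: "((\<lambda>k. \<beta> k g + \<beta> k (inv g)) \<longlongrightarrow> 0) F" if "g \<in> H" for g
    using tendsto_diff[OF one hom[of g "inv g"]] that by simp
  have incl: "derived G H \<subseteq> H" using derived_incl[OF order_refl H] .
  have comm: "((\<lambda>k. \<beta> k c) \<longlongrightarrow> 0) F" if c: "c \<in> derived_set G H" for c
  proof -
    obtain u v where uv: "u \<in> H" "v \<in> H" "c = u \<otimes> v \<otimes> inv u \<otimes> inv v" using c by blast
    have "((\<lambda>k. (\<beta> k c - \<beta> k (u \<otimes> v \<otimes> inv u) - \<beta> k (inv v))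
        + (\<beta> k (u \<otimes> v \<otimes> inv u) - \<beta> k (u \<otimes> v) - \<beta> k (inv u))
        + (\<beta> k (u \<otimes> v) - \<beta> k u - \<beta> k v)
        + (\<beta> k u + \<beta> k (inv u)) + (\<beta> k v + \<beta> k (inv v))) \<longlongrightarrow> 0 + 0 + 0 + 0 + 0) F"
      unfolding uv(3) using uv by (intro tendsto_add hom inv_sum) auto
    then show ?thesis by (simp add: algebra_simps)
  qed
  have "g \<in> generate G (derived_set G H)" using g by (simp add: derived_def)
  then show ?thesis
  proof (induction g)
    case one
    then show ?case by (rule \<open>((\<lambda>k. \<beta> k \<one>) \<longlongrightarrow> 0) F\<close>)
  next
    case (incl h)
    then show ?case by (rule comm)
  next
    case (inv h)
    have "h \<in> H" using inv derived_set_incl[OF order_refl H] by blast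
    then show ?case using tendsto_diff[OF inv_sum[OF \<open>h \<in> H\<close>] comm[OF inv]] by simp
  next
    case (eng h1 h2)
    have "h1 \<in> H" "h2 \<in> H" using eng(1,2) incl unfolding derived_def by auto
    then show ?case using tendsto_add[OF eng.IH] by (intro mult) auto
  qed
qed

section \<open>Translation lengths\<close>

lemma bdd_below_displacement: "bdd_below ((\<lambda>x. dist x (f x)) ` X)"
  by (rule bdd_belowI2[of _ 0]) simp

lemma translation_length_le: "x \<in> X \<Longrightarrow> translation_length X f \<le> dist x (f x)"
  unfolding translation_length_def by (rule cINF_lower[OF bdd_below_displacement])

lemma translation_length_nonneg: "X \<noteq> {} \<Longrightarrow> 0 \<le> translation_length X f"
  unfolding translation_length_def by (rule cINF_greatest) auto

lemma elliptic_or_neutral_parabolic: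
  assumes "translation_length X f = 0"
  shows "elliptic X f \<or> neutral_parabolic X f"
  using assms by (auto simp: neutral_parabolic_def parabolic_def elliptic_def) metis

locale isometric_group_action =
  fixes G :: "('g, 'm) monoid_scheme" (structure) and X :: "'x::metric_space set"
    and \<phi> :: "'g \<Rightarrow> 'x \<Rightarrow> 'x"
  assumes isometric: "isometric_action G X \<phi>"
begin

sublocale group_action G X \<phi>
  using isometric by (simp add: isometric_action_def)

sublocale group G
  using group_hom group_hom.axioms(1) by auto

lemma act_closed [simp]: "g \<in> carrier G \<Longrightarrow> x \<in> X \<Longrightarrow> \<phi> g x \<in> X"
  using element_image by blast

lemma act_dist [simp]:
  "g \<in> carrier G \<Longrightarrow> x \<in> X \<Longrightarrow> y \<in> X \<Longrightarrow> dist (\<phi> g x) (\<phi> g y) = dist x y"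
  using isometric by (simp add: isometric_action_def)

lemma act_mult: "g \<in> carrier G \<Longrightarrow> h \<in> carrier G \<Longrightarrow> x \<in> X \<Longrightarrow> \<phi> (g \<otimes> h) x = \<phi> g (\<phi> h x)"
  by (rule composition_rule)

lemma act_one [simp]: "x \<in> X \<Longrightarrow> \<phi> \<one> x = x"
  using id_eq_one by (metis restrict_apply')

lemma act_inv [simp]:
  "g \<in> carrier G \<Longrightarrow> x \<in> X \<Longrightarrow> \<phi> (inv g) (\<phi> g x) = x"
  "g \<in> carrier G \<Longrightarrow> x \<in> X \<Longrightarrow> \<phi> g (\<phi> (inv g) x) = x"
  by (simp_all flip: act_mult)

lemma dist_act_left:
  "g \<in> carrier G \<Longrightarrow> x \<in> X \<Longrightarrow> y \<in> X \<Longrightarrow> dist (\<phi> g x) y = dist x (\<phi> (inv g) y)"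
  by (metis act_closed act_dist act_inv(2) inv_closed)

lemma cn_midpoint_act:
  assumes "g \<in> carrier G" "cn_midpoint X y z m" "y \<in> X" "z \<in> X"
  shows "cn_midpoint X (\<phi> g y) (\<phi> g z) (\<phi> g m)"
proof -
  have m: "m \<in> X" using assms by (simp add: cn_midpoint_def)
  have "(dist x (\<phi> g m))\<^sup>2
      \<le> (dist x (\<phi> g y))\<^sup>2 / 2 + (dist x (\<phi> g z))\<^sup>2 / 2 - (dist (\<phi> g y) (\<phi> g z))\<^sup>2 / 4"
    if "x \<in> X" for x
  proof -
    have "dist x (\<phi> g p) = dist (\<phi> (inv g) x) p" if "p \<in> X" for p
      using dist_act_left[of "inv g" x p] \<open>x \<in> X\<close> that assms(1) by simp
    then show ?thesis
      using assms that m by (simp add: cn_midpoint_def)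
  qed
  then show ?thesis using assms m by (simp add: cn_midpoint_def)
qed

lemma translation_length_conj_le:
  assumes "X \<noteq> {}" "g \<in> carrier G" "h \<in> carrier G"
  shows "translation_length X (\<phi> (h \<otimes> g \<otimes> inv h)) \<le> translation_length X (\<phi> g)"
  unfolding translation_length_def[of X "\<phi> g"]
proof (rule cINF_greatest[OF assms(1)])
  fix x assume x: "x \<in> X"
  have "translation_length X (\<phi> (h \<otimes> g \<otimes> inv h)) \<le> dist (\<phi> h x) (\<phi> (h \<otimes> g \<otimes> inv h) (\<phi> h x))"
    using x assms by (intro translation_length_le) simp
  also have "\<dots> = dist x (\<phi> g x)"
    using x assms by (simp add: act_mult)
  finally show "translation_length X (\<phi> (h \<otimes> g \<otimes> inv h)) \<le> dist x (\<phi> g x)" .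
qed

text \<open>The midpoints of \<open>x, g x\<close> and of \<open>g x, g\<^sup>2 x\<close> are again related by \<open>g\<close>, and by convexity they
  are at most half as far apart as \<open>x\<close> and \<open>g\<^sup>2 x\<close>.\<close>

lemma translation_length_square:
  assumes "cn_space X" "X \<noteq> {}" "g \<in> carrier G"
  shows "2 * translation_length X (\<phi> g) \<le> translation_length X (\<phi> (g \<otimes> g))"
  unfolding translation_length_def[of X "\<phi> (g \<otimes> g)"]
proof (rule cINF_greatest[OF assms(2)])
  fix x assume x: "x \<in> X"
  obtain m where m: "cn_midpoint X x (\<phi> g x) m"
    using assms x unfolding cn_space_def by (meson act_closed)
  then have "m \<in> X" by (simp add: cn_midpoint_def)
  have "cn_midpoint X (\<phi> g x) (\<phi> g (\<phi> g x)) (\<phi> g m)"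
    using assms x m by (intro cn_midpoint_act) auto
  then have "2 * dist m (\<phi> g m) \<le> dist x (\<phi> g (\<phi> g x))"
    using cn_midpoints_of_triangle_sides[OF m] x assms by simp
  then show "2 * translation_length X (\<phi> g) \<le> dist x (\<phi> (g \<otimes> g) x)"
    using translation_length_le[OF \<open>m \<in> X\<close>, of "\<phi> g"] x assms by (simp add: act_mult)
qed

lemma translation_length_pow2:
  assumes "cn_space X" "X \<noteq> {}" "g \<in> carrier G"
  shows "2 ^ k * translation_length X (\<phi> g) \<le> translation_length X (\<phi> (g [^] (2 ^ k :: nat)))"
proof (induction k)
  case 0
  then show ?case using assms by simp
next
  case (Suc k)
  have "g [^] (2 ^ Suc k :: nat) = g [^] (2 ^ k :: nat) \<otimes> g [^] (2 ^ k :: nat)"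
    using assms by (simp add: nat_pow_mult mult_2)
  then show ?case
    using Suc translation_length_square[of "g [^] (2 ^ k :: nat)"] assms by simp
qed

text \<open>Fix a point \<open>x\<close>. The functions \<open>\<beta>\<^sub>k(h) = d(h x, g\<^sup>k\<^sup>+\<^sup>1 x) - d(x, g\<^sup>k\<^sup>+\<^sup>1 x)\<close> on the centralizer of \<open>g\<close>
  play the role of the Busemann function at the limit point of the orbit \<open>g\<^sup>k x\<close>. An element \<open>u\<close> of the
  centralizer moves every point \<open>g\<^sup>k x\<close> by the same distance \<open>d(x, u x)\<close>, and the estimate for far
  pairs of points makes \<open>\<beta>\<^sub>k\<close> additive up to an error of order \<open>1 / d(x, g\<^sup>k\<^sup>+\<^sup>1 x)\<close>. If \<open>g\<close> is a product
  of commutators in its centralizer, then \<open>\<beta>\<^sub>k(g) = d(x, g\<^sup>k x) - d(x, g\<^sup>k\<^sup>+\<^sup>1 x)\<close> is therefore small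
  whenever \<open>d(x, g\<^sup>k\<^sup>+\<^sup>1 x)\<close> is large. So if \<open>\<parallel>g\<parallel> > 0\<close>, then outside a bounded set each step
  takes the orbit away from \<open>x\<close> by less than \<open>\<parallel>g\<parallel> / 2\<close>, whereas the doubling of translation
  lengths forces a distance of at least \<open>2\<^sup>m \<parallel>g\<parallel>\<close> after \<open>2\<^sup>m\<close> steps.\<close>

lemma translation_length_eq_0_if_derived_centralizer:
  assumes X: "cn_space X" "X \<noteq> {}"
    and gG: "g \<in> carrier G" and g: "g \<in> derived G (centralizer G g)"
  shows "translation_length X (\<phi> g) = 0"
proof (rule ccontr)
  define Z where "Z = centralizer G g"
  have Z: "subgroup Z G" unfolding Z_def by (rule subgroup_centralizer[OF gG])
  interpret Z: subgroup Z G by (rule Z)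
  have central: "g \<otimes> h = h \<otimes> g" if "h \<in> Z" for h
    using that unfolding Z_def centralizer_def by blast
  have gZ: "g \<in> Z" using gG unfolding Z_def centralizer_def by blast
  assume "translation_length X (\<phi> g) \<noteq> 0"
  then have pos: "translation_length X (\<phi> g) > 0" (is "?L > 0")
    using translation_length_nonneg[OF X(2), of "\<phi> g"] by simp
  obtain x where x: "x \<in> X" using X by blast
  define z where "z k = \<phi> (g [^] k) x" for k :: nat
  have zX: "z k \<in> X" for k using x gG by (simp add: z_def)
  have z_shift: "\<phi> h (z k) = \<phi> (g [^] k) (\<phi> h x)" if "h \<in> Z" for h k
    using that central[OF that] gG x
    by (simp add: z_def flip: act_mult) (metis Z.mem_carrier group_commutes_pow)
  define D where "D k = dist x (z k)" for k
  \<comment> \<open>The filter expresses that the orbit is far away, so that the distances tend to infinity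
    along it by construction.\<close>
  define F where "F = filtercomap (\<lambda>k. D (Suc k)) at_top"
  define \<beta> where "\<beta> k h = dist (\<phi> h x) (z (Suc k)) - D (Suc k)" for k h
  have lim_D: "filterlim (\<lambda>k. D (Suc k)) at_top F"
    unfolding F_def by (rule filterlim_filtercomap)
  have hom: "((\<lambda>k. \<beta> k (u \<otimes> v) - \<beta> k u - \<beta> k v) \<longlongrightarrow> 0) F" if u: "u \<in> Z" and v: "v \<in> Z" for u v
  proof -
    define C where "C = 2 * ((dist x (\<phi> v x))\<^sup>2 + (dist x (\<phi> (inv u) x))\<^sup>2)"
    have bound: "\<bar>\<beta> k (u \<otimes> v) - \<beta> k u - \<beta> k v\<bar> * D (Suc k) \<le> C" for k
    proof -
      have "\<beta> k (u \<otimes> v) = dist (\<phi> v x) (\<phi> (inv u) (z (Suc k))) - D (Suc k)"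
        "\<beta> k u = dist x (\<phi> (inv u) (z (Suc k))) - D (Suc k)"
        using u v x zX by (simp_all add: \<beta>_def act_mult dist_act_left)
      moreover have "dist (z (Suc k)) (\<phi> (inv u) (z (Suc k))) = dist x (\<phi> (inv u) x)"
        using z_shift[of "inv u" "Suc k"] u x gG by (simp add: z_def)
      ultimately show ?thesis
        using cn_space_far_pairs[OF X(1) x, of "\<phi> v x" "z (Suc k)" "\<phi> (inv u) (z (Suc k))"] u v x zX
        by (simp add: C_def D_def \<beta>_def abs_minus_commute algebra_simps)
    qed
    have "((\<lambda>k. C / D (Suc k)) \<longlongrightarrow> 0) F"
      by (rule real_tendsto_divide_at_top[OF tendsto_const lim_D])
    moreover have "\<forall>\<^sub>F k in F. D (Suc k) > 0"
      using lim_D by (simp add: filterlim_at_top_dense)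
    then have "\<forall>\<^sub>F k in F. norm (\<beta> k (u \<otimes> v) - \<beta> k u - \<beta> k v) \<le> C / D (Suc k)"
      by eventually_elim (use bound in \<open>simp add: pos_le_divide_eq\<close>)
    ultimately show ?thesis by (rule Lim_null_comparison[rotated])
  qed
  have "((\<lambda>k. \<beta> k g) \<longlongrightarrow> 0) F"
    by (rule asymptotic_hom_vanishes_on_derived[OF Z hom g[folded Z_def]])
  moreover have "\<beta> k g = D k - D (Suc k)" for k
  proof -
    have "z (Suc k) = \<phi> g (z k)"
      using z_shift[OF gZ, of k] gG x by (simp add: z_def act_mult)
    then show ?thesis using gG x zX by (simp add: \<beta>_def D_def)
  qed
  ultimately have "\<forall>\<^sub>F k in F. \<bar>D k - D (Suc k)\<bar> < ?L / 2"
    using tendstoD[of "\<lambda>k. \<beta> k g" 0 F "?L / 2"] pos by (simp add: dist_real_def)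
  then obtain K where K: "\<And>k. D (Suc k) \<ge> K \<Longrightarrow> \<bar>D k - D (Suc k)\<bar> < ?L / 2"
    unfolding F_def eventually_filtercomap eventually_at_top_linorder by blast
  have slow: "D k \<le> \<bar>K\<bar> + k * (?L / 2)" for k
  proof (induction k)
    case 0
    then show ?case using x by (simp add: D_def z_def)
  next
    case (Suc k)
    show ?case
    proof (cases "D (Suc k) \<ge> K")
      case True
      have "real (Suc k) * (?L / 2) = k * (?L / 2) + ?L / 2"
        by (simp add: distrib_right add_divide_distrib)
      then show ?thesis using K[OF True] Suc by linarith
    next
      case False
      have "0 \<le> real (Suc k) * (?L / 2)" using pos by simp
      then show ?thesis using False by linarith
    qed
  qed
  obtain k where k: "\<bar>K\<bar> / (?L / 2) < 2 ^ k"
    using real_arch_pow[of 2] by auto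
  have "2 ^ k * ?L \<le> D (2 ^ k)"
    using translation_length_pow2[OF X gG, of k]
      translation_length_le[OF x, of "\<phi> (g [^] (2 ^ k :: nat))"]
    by (simp add: D_def z_def)
  then have "2 ^ k * (?L / 2) \<le> \<bar>K\<bar>"
    using slow[of "2 ^ k"] by (simp add: algebra_simps)
  then show False
    using k pos by (simp add: divide_less_eq)
qed

end

section \<open>Relations between Nielsen automorphisms\<close>

lemma carrier_AutoGroup [simp]: "carrier (AutoGroup G) = auto G"
  by (simp add: AutoGroup_def)

lemma AutoGroup_mult_apply:
  "f \<in> auto G \<Longrightarrow> g \<in> auto G \<Longrightarrow> x \<in> carrier G \<Longrightarrow> (f \<otimes>\<^bsub>AutoGroup G\<^esub> g) x = f (g x)"
  by (simp add: AutoGroup_def BijGroup_def auto_def compose_eq)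

lemma AutoGroup_one_apply: "x \<in> carrier G \<Longrightarrow> \<one>\<^bsub>AutoGroup G\<^esub> x = x"
  by (simp add: AutoGroup_def BijGroup_def)

lemma (in group) AutoGroup_inv_apply:
  assumes "f \<in> auto G" "x \<in> carrier G" "f x = y"
  shows "(inv\<^bsub>AutoGroup G\<^esub> f) y = x"
proof -
  interpret A: group "AutoGroup G" by (rule AutoGroup)
  have "inv\<^bsub>AutoGroup G\<^esub> f \<in> auto G" using assms A.inv_closed[of f] by simp
  then have "(inv\<^bsub>AutoGroup G\<^esub> f) (f x) = (inv\<^bsub>AutoGroup G\<^esub> f \<otimes>\<^bsub>AutoGroup G\<^esub> f) x"
    by (simp only: AutoGroup_mult_apply assms)
  also have "\<dots> = x"
    using assms by (simp add: AutoGroup_one_apply)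
  finally show ?thesis using assms by simp
qed

locale free_group_automorphisms =
  fixes n :: nat
begin

abbreviation "F \<equiv> free_group n"
abbreviation "A \<equiv> AutoGroup F"
abbreviation "lam \<equiv> nielsen_lambda n"
abbreviation "rho \<equiv> nielsen_rho n"

sublocale F: group F by (rule group_free_group)
sublocale A: group A by (rule F.AutoGroup)

lemma auto_apply:
  assumes "f \<in> auto F"
  shows "x \<in> carrier F \<Longrightarrow> f x \<in> carrier F"
    and "x \<in> carrier F \<Longrightarrow> y \<in> carrier F \<Longrightarrow> f (x \<otimes>\<^bsub>F\<^esub> y) = f x \<otimes>\<^bsub>F\<^esub> f y"
    and "x \<in> carrier F \<Longrightarrow> f (inv\<^bsub>F\<^esub> x) = inv\<^bsub>F\<^esub> (f x)"
proof -
  have "f \<in> hom F F" using assms by (simp add: auto_def)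
  then interpret group_hom F F f
    by (simp add: group_hom_def group_hom_axioms_def F.is_group)
  show "x \<in> carrier F \<Longrightarrow> f x \<in> carrier F"
    "x \<in> carrier F \<Longrightarrow> y \<in> carrier F \<Longrightarrow> f (x \<otimes>\<^bsub>F\<^esub> y) = f x \<otimes>\<^bsub>F\<^esub> f y"
    "x \<in> carrier F \<Longrightarrow> f (inv\<^bsub>F\<^esub> x) = inv\<^bsub>F\<^esub> (f x)"
    by simp_all
qed

lemma auto_eqI:
  assumes "f \<in> auto F" "g \<in> auto F" "\<And>k. k \<in> {1..n} \<Longrightarrow> f (gen k) = g (gen k)"
  shows "f = g"
proof (rule extensionalityI)
  show "f \<in> extensional (carrier F)" "g \<in> extensional (carrier F)"
    using assms by (auto simp: auto_def Bij_def)
  show "f x = g x" if "x \<in> carrier F" for x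
    using F.hom_free_group_unique[of f n g x] assms that by (simp add: auto_def)
qed

lemma A_closed:
  "f \<in> auto F \<Longrightarrow> g \<in> auto F \<Longrightarrow> f \<otimes>\<^bsub>A\<^esub> g \<in> auto F" "f \<in> auto F \<Longrightarrow> inv\<^bsub>A\<^esub> f \<in> auto F"
  using A.m_closed[of f g] A.inv_closed[of f] by simp_all

lemmas nielsen_closed = nielsen_auto[of _ n]

lemma nielsen_inv_gen:
  assumes "i \<in> {1..n}" "j \<in> {1..n}" "i \<noteq> j" "k \<in> {1..n}"
  shows "(inv\<^bsub>A\<^esub> (lam i j)) (gen k) = (if k = i then inv\<^bsub>F\<^esub> (gen j) \<otimes>\<^bsub>F\<^esub> gen i else gen k)"
    and "(inv\<^bsub>A\<^esub> (rho i j)) (gen k) = (if k = i then gen i \<otimes>\<^bsub>F\<^esub> inv\<^bsub>F\<^esub> (gen j) else gen k)"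
proof -
  note gens = gen_in_free_group[of _ n]
  show "(inv\<^bsub>A\<^esub> (lam i j)) (gen k) = (if k = i then inv\<^bsub>F\<^esub> (gen j) \<otimes>\<^bsub>F\<^esub> gen i else gen k)"
    using assms
    by (intro F.AutoGroup_inv_apply)
      (auto simp: nielsen_closed gens auto_apply nielsen_gen F.m_assoc[symmetric])
  show "(inv\<^bsub>A\<^esub> (rho i j)) (gen k) = (if k = i then gen i \<otimes>\<^bsub>F\<^esub> inv\<^bsub>F\<^esub> (gen j) else gen k)"
    using assms
    by (intro F.AutoGroup_inv_apply)
      (auto simp: nielsen_closed gens auto_apply nielsen_gen F.m_assoc)
qed

lemmas nielsen_apply =
  nielsen_closed(1)[THEN auto_apply(1)] nielsen_closed(1)[THEN auto_apply(2)]
  nielsen_closed(1)[THEN auto_apply(3)]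
  nielsen_closed(2)[THEN auto_apply(1)] nielsen_closed(2)[THEN auto_apply(2)]
  nielsen_closed(2)[THEN auto_apply(3)]
  nielsen_closed(1)[THEN A_closed(2), THEN auto_apply(1)]
  nielsen_closed(1)[THEN A_closed(2), THEN auto_apply(2)]
  nielsen_closed(1)[THEN A_closed(2), THEN auto_apply(3)]
  nielsen_closed(2)[THEN A_closed(2), THEN auto_apply(1)]
  nielsen_closed(2)[THEN A_closed(2), THEN auto_apply(2)]
  nielsen_closed(2)[THEN A_closed(2), THEN auto_apply(3)]

text \<open>Rewriting with these facts reduces an identity between composites of Nielsen automorphisms, once
  it is applied to a basis element, to an identity between words.\<close>

lemmas evaluate = AutoGroup_mult_apply nielsen_apply nielsen_closed A_closed
  gen_in_free_group[of _ n] nielsen_gen[where n = n] nielsen_inv_gen F.m_assoc F.inv_mult_group F.cancel_left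

text \<open>For distinct indices this is the automorphism \<open>a\<^sub>j \<mapsto> a\<^sub>k a\<^sub>j a\<^sub>k\<^sup>-\<^sup>1\<close>, \<open>a\<^sub>i \<mapsto> a\<^sub>k a\<^sub>i\<close>. View the
  free group as an HNN extension with stable letter \<open>a\<^sub>i\<close>, which conjugates \<open>a\<^sub>i\<^sup>-\<^sup>1 a\<^sub>j a\<^sub>i\<close> to
  \<open>a\<^sub>j\<close>; then \<open>\<lambda>\<^sub>i\<^sub>j\<close> is the twist of this splitting. Conjugating \<open>a\<^sub>j\<close> by \<open>a\<^sub>k\<close> and
  dragging \<open>a\<^sub>i\<close> along preserves the splitting, so that it commutes with the twist.\<close>

definition pushing :: "nat \<Rightarrow> nat \<Rightarrow> nat \<Rightarrow> word \<Rightarrow> word" where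
  "pushing i j k = lam j k \<otimes>\<^bsub>A\<^esub> inv\<^bsub>A\<^esub> (rho j k) \<otimes>\<^bsub>A\<^esub> lam i k"

text \<open>Let \<open>E\<close> be the pushing automorphism. Conjugating \<open>E\<close> by \<open>\<lambda>\<^sub>k\<^sub>j\<close> makes it push \<open>a\<^sub>j\<close> and \<open>a\<^sub>i\<close> along
  \<open>a\<^sub>j a\<^sub>k\<close> instead of \<open>a\<^sub>k\<close>, and the additional \<open>a\<^sub>j\<close> contributes exactly the twist \<open>\<lambda>\<^sub>i\<^sub>j\<close>,
  together with a conjugation of \<open>a\<^sub>k\<close> by \<open>a\<^sub>j\<close>. This gives
  \<open>\<lambda>\<^sub>i\<^sub>j = \<rho>\<^sub>k\<^sub>j [\<lambda>\<^sub>k\<^sub>j, E] \<lambda>\<^sub>k\<^sub>j\<^sup>-\<^sup>1\<close>. The index \<open>l\<close> serves to write \<open>\<lambda>\<^sub>k\<^sub>j\<close> and \<open>\<rho>\<^sub>k\<^sub>j\<close> as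
  commutators in the centralizer as well.\<close>

lemma nielsen_lambda_in_derived_centralizer:
  assumes ijkl: "i \<in> {1..n}" "j \<in> {1..n}" "k \<in> {1..n}" "l \<in> {1..n}"
    and distinct: "distinct [i, j, k, l]"
  shows "lam i j \<in> derived A (centralizer A (lam i j))"
proof -
  define Z where "Z = centralizer A (lam i j)"
  have neq: "i \<noteq> j" "i \<noteq> k" "i \<noteq> l" "j \<noteq> k" "j \<noteq> l" "k \<noteq> l"
    "j \<noteq> i" "k \<noteq> i" "l \<noteq> i" "k \<noteq> j" "l \<noteq> j" "l \<noteq> k"
    using distinct by auto
  \<comment> \<open>Hiding the interval keeps the simplifier from turning membership into inequalities and
    then splitting on the disequations between the indices.\<close>
  define N where "N = {1..n}"
  note ev = evaluate[folded N_def] ijkl[folded N_def] neq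
  have aut: "lam k j \<in> auto F" "rho k j \<in> auto F" "pushing i j k \<in> auto F" "lam i j \<in> auto F"
    by (simp_all add: pushing_def ev)
  have sub: "subgroup Z A" unfolding Z_def using aut(4) by (intro A.subgroup_centralizer) simp
  interpret Z: subgroup Z A by (rule sub)
  have eqI: "f = g"
    if "f \<in> auto F" "g \<in> auto F"
      and "f (gen i) = g (gen i)" "f (gen j) = g (gen j)" "f (gen k) = g (gen k)"
        "f (gen l) = g (gen l)"
      and "\<And>m. m \<in> N \<Longrightarrow> m \<noteq> i \<Longrightarrow> m \<noteq> j \<Longrightarrow> m \<noteq> k \<Longrightarrow> m \<noteq> l \<Longrightarrow> f (gen m) = g (gen m)"
    for f g
    using that unfolding N_def by (intro auto_eqI) blast+
  have mem_Z: "g \<in> Z" if "g \<in> auto F" "lam i j \<otimes>\<^bsub>A\<^esub> g = g \<otimes>\<^bsub>A\<^esub> lam i j" for g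
    using that by (simp add: Z_def centralizer_def)
  have lam_kl: "lam k l \<in> Z" by (rule mem_Z; (rule eqI)?; simp add: ev)
  have lam_lj: "lam l j \<in> Z" by (rule mem_Z; (rule eqI)?; simp add: ev)
  have lam_kj: "lam k j \<in> Z" by (rule mem_Z; (rule eqI)?; simp add: ev)
  have rho_kl: "rho k l \<in> Z" by (rule mem_Z; (rule eqI)?; simp add: ev)
  have rho_lj: "rho l j \<in> Z" by (rule mem_Z; (rule eqI)?; simp add: ev)
  have push: "pushing i j k \<in> Z"
    unfolding pushing_def by (rule mem_Z; (rule eqI)?; simp add: ev)
  have "lam l j \<otimes>\<^bsub>A\<^esub> lam k l = lam k l \<otimes>\<^bsub>A\<^esub> lam l j \<otimes>\<^bsub>A\<^esub> lam k j"
    by (rule eqI; simp add: ev)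
  then have lam_kj_derived: "lam k j \<in> derived A Z"
    using lam_kl lam_lj aut by (intro A.mem_derived_if_swap[OF sub]) simp_all
  have "rho l j \<otimes>\<^bsub>A\<^esub> rho k l = rho k l \<otimes>\<^bsub>A\<^esub> rho l j \<otimes>\<^bsub>A\<^esub> rho k j"
    by (rule eqI; simp add: ev)
  then have rho_kj_derived: "rho k j \<in> derived A Z"
    using rho_kl rho_lj aut by (intro A.mem_derived_if_swap[OF sub]) simp_all
  have "rho k j \<otimes>\<^bsub>A\<^esub> lam k j \<otimes>\<^bsub>A\<^esub> pushing i j k
      = lam i j \<otimes>\<^bsub>A\<^esub> lam k j \<otimes>\<^bsub>A\<^esub> pushing i j k \<otimes>\<^bsub>A\<^esub> lam k j"
    unfolding pushing_def by (rule eqI; simp add: ev)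
  then have "lam i j = rho k j
      \<otimes>\<^bsub>A\<^esub> (lam k j \<otimes>\<^bsub>A\<^esub> pushing i j k \<otimes>\<^bsub>A\<^esub> inv\<^bsub>A\<^esub> lam k j \<otimes>\<^bsub>A\<^esub> inv\<^bsub>A\<^esub> pushing i j k)
      \<otimes>\<^bsub>A\<^esub> inv\<^bsub>A\<^esub> lam k j"
    (is "?x = ?q \<otimes>\<^bsub>A\<^esub> (?p \<otimes>\<^bsub>A\<^esub> ?e \<otimes>\<^bsub>A\<^esub> inv\<^bsub>A\<^esub> ?p \<otimes>\<^bsub>A\<^esub> inv\<^bsub>A\<^esub> ?e) \<otimes>\<^bsub>A\<^esub> inv\<^bsub>A\<^esub> ?p")
  proof -
    note [simp] = aut A_closed
    assume eq: "?q \<otimes>\<^bsub>A\<^esub> ?p \<otimes>\<^bsub>A\<^esub> ?e = ?x \<otimes>\<^bsub>A\<^esub> ?p \<otimes>\<^bsub>A\<^esub> ?e \<otimes>\<^bsub>A\<^esub> ?p"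
    have "?x = ?x \<otimes>\<^bsub>A\<^esub> ?p \<otimes>\<^bsub>A\<^esub> ?e \<otimes>\<^bsub>A\<^esub> ?p \<otimes>\<^bsub>A\<^esub> (inv\<^bsub>A\<^esub> ?p \<otimes>\<^bsub>A\<^esub> inv\<^bsub>A\<^esub> ?e \<otimes>\<^bsub>A\<^esub> inv\<^bsub>A\<^esub> ?p)"
      by (simp add: A.m_assoc A.cancel_left)
    also have "\<dots> = ?q \<otimes>\<^bsub>A\<^esub> (?p \<otimes>\<^bsub>A\<^esub> ?e \<otimes>\<^bsub>A\<^esub> inv\<^bsub>A\<^esub> ?p \<otimes>\<^bsub>A\<^esub> inv\<^bsub>A\<^esub> ?e) \<otimes>\<^bsub>A\<^esub> inv\<^bsub>A\<^esub> ?p"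
      unfolding eq[symmetric] by (simp add: A.m_assoc)
    finally show ?thesis .
  qed
  moreover have "lam k j \<otimes>\<^bsub>A\<^esub> pushing i j k \<otimes>\<^bsub>A\<^esub> inv\<^bsub>A\<^esub> lam k j \<otimes>\<^bsub>A\<^esub> inv\<^bsub>A\<^esub> pushing i j k \<in> derived A Z"
    unfolding derived_def using lam_kj push by (intro generate.incl) blast
  ultimately show ?thesis
    unfolding Z_def[symmetric] using lam_kj_derived rho_kj_derived
    by (metis A.derived_is_subgroup Z.subset subgroup.m_closed subgroup.m_inv_closed)
qed

definition invert_basis :: "word \<Rightarrow> word" where
  "invert_basis = free_lift n F (\<lambda>k. inv\<^bsub>F\<^esub> (gen k))"

lemma invert_basis_gen: "k \<in> {1..n} \<Longrightarrow> invert_basis (gen k) = inv\<^bsub>F\<^esub> (gen k)"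
  unfolding invert_basis_def by (rule F.free_lift_gen) (simp_all add: gen_in_free_group)

lemma invert_basis_auto: "invert_basis \<in> auto F"
proof -
  have closed: "inv\<^bsub>F\<^esub> (gen k) \<in> carrier F" if "k \<in> {1..n}" for k
    using that by (simp add: gen_in_free_group)
  interpret invert: group_hom F F invert_basis
    using F.free_lift_hom[of n "\<lambda>k. inv\<^bsub>F\<^esub> (gen k)"] closed
    by (simp add: invert_basis_def group_hom_def group_hom_axioms_def F.is_group)
  have "invert_basis (inv\<^bsub>F\<^esub> (gen k)) = gen k" if "k \<in> {1..n}" for k
    using that by (simp add: invert_basis_gen gen_in_free_group)
  then show ?thesis
    unfolding invert_basis_def
    by (intro free_group_auto_of_inverse[where t = "\<lambda>k. inv\<^bsub>F\<^esub> (gen k)"] closed)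
qed

lemma nielsen_rho_conj_nielsen_lambda:
  assumes "i \<in> {1..n}" "j \<in> {1..n}" "i \<noteq> j"
  shows "rho i j = invert_basis \<otimes>\<^bsub>A\<^esub> lam i j \<otimes>\<^bsub>A\<^esub> inv\<^bsub>A\<^esub> invert_basis"
proof -
  have "rho i j \<otimes>\<^bsub>A\<^esub> invert_basis = invert_basis \<otimes>\<^bsub>A\<^esub> lam i j"
    using assms invert_basis_auto auto_apply[OF invert_basis_auto]
    by (intro auto_eqI) (auto simp: evaluate invert_basis_gen)
  then show ?thesis
    using assms invert_basis_auto by (subst A.inv_solve_right) (auto simp: evaluate)
qed

end

section \<open>Nielsen generators have zero translation length\<close>

theorem proposition8p2:
  fixes n :: nat and X :: "'x::metric_space set"
    and \<phi> :: "(word \<Rightarrow> word) \<Rightarrow> 'x \<Rightarrow> 'x"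
  assumes "n \<ge> 6"
    and "X \<noteq> {}" and "complete X" and "CAT0_space X"
    and "isometric_action (AutoGroup (free_group n)) X \<phi>"
    and "i \<in> {1..n}" and "j \<in> {1..n}" and "i \<noteq> j"
  shows "translation_length X (\<phi> (nielsen_lambda n i j)) = 0 \<and>
         translation_length X (\<phi> (nielsen_rho n i j)) = 0 \<and>
         (elliptic X (\<phi> (nielsen_lambda n i j)) \<or> neutral_parabolic X (\<phi> (nielsen_lambda n i j))) \<and>
         (elliptic X (\<phi> (nielsen_rho n i j)) \<or> neutral_parabolic X (\<phi> (nielsen_rho n i j)))"
proof -
  interpret isometric_group_action "AutoGroup (free_group n)" X \<phi>
    using assms(5) by unfold_locales
  interpret free_group_automorphisms n .
  have cn: "cn_space X" by (rule CAT0_imp_cn_space[OF assms(4)])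
  have "\<exists>k \<in> {1, 2, 3}. k \<noteq> i \<and> k \<noteq> j" by auto
  then obtain k where k: "k \<in> {1, 2, 3}" "k \<noteq> i" "k \<noteq> j" by blast
  have "\<exists>l \<in> {1, 2, 3, 4}. l \<noteq> i \<and> l \<noteq> j \<and> l \<noteq> k" by auto
  then obtain l where l: "l \<in> {1, 2, 3, 4}" "l \<noteq> i" "l \<noteq> j" "l \<noteq> k" by blast
  have kl: "k \<in> {1..n}" "l \<in> {1..n}" using assms(1) k(1) l(1) by auto
  have lam: "lam i j \<in> carrier A" using assms nielsen_closed by simp
  have lam_0: "translation_length X (\<phi> (lam i j)) = 0"
    using assms kl k(2,3) l(2-4) lam
    by (intro translation_length_eq_0_if_derived_centralizer cn
        nielsen_lambda_in_derived_centralizer[of i j k l]) simp_all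
  moreover have "translation_length X (\<phi> (rho i j)) \<le> translation_length X (\<phi> (lam i j))"
    unfolding nielsen_rho_conj_nielsen_lambda[OF assms(6-8)]
    using assms lam invert_basis_auto by (intro translation_length_conj_le) auto
  then have "translation_length X (\<phi> (rho i j)) = 0"
    using lam_0 translation_length_nonneg[OF assms(2), of "\<phi> (rho i j)"] by simp
  ultimately show ?thesis
    using elliptic_or_neutral_parabolic by blast
qed

end
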